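(* Let $p$ be prime, $k\ge1$ and $L\in GL_k(\mathbb{F}_p)$. Let $W$ be the set of $p\times p$ integer arrays all of whose row sums and all of whose column sums are equal to a common value $\gamma(a)$. The following are equivalent. (i) $\operatorname{supp}(L^{\mathsf T}s)\ne\operatorname{supp}(s)$ for every $s\in\mathbb{F}_p^k\setminus\{0\}$. (ii) For every $a_1,\dots,a_k\in W$, $$\sum_{v\in\mathbb{F}_p^k}\prod_{i=1}^{k}a_i\big((Lv)_i,\,v_i\big)=\sum_{v\in\mathbb{F}_p^k}\prod_{i=1}^{k}a_i\big((Lv)_i,\,p-1-v_i\big)=\prod_{i=1}^{k}\gamma(a_i).$$ Moreover, each of the two identities in (ii), taken alone (that is, either the statement that for all $a_1,\dots,a_k\in W$ the first sum equals $\prod_i\gamma(a_i)$, or the statement that for all $a_1,\dots,a_k\in W$ the second sum equals $\prod_i\gamma(a_i)$), is already equivalent to (i).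
   Context: For $s\in\mathbb{F}_p^k$, $\operatorname{supp}(s)=\{i: s_i\ne0\}$. A $p\times p$ array $a$ is a function $a:\mathbb{F}_p\times\mathbb{F}_p\to\mathbb{Z}$, $(x,y)\mapsto a(x,y)$, where $\mathbb{F}_p$ is identified with the index set $\{0,1,\dots,p-1\}$; $x$ is the row index and $y$ the column index. *)

theory Defs
  imports "HOL-Analysis.Analysis" "Berlekamp_Zassenhaus.Finite_Field"
begin

text \<open>
  The field \<open>\<F>\<^sub>p\<close> is \<open>'p mod_ring\<close> with \<open>'p :: prime_card\<close>, so that \<open>p = CARD('p)\<close> is an arbitrary
  prime; \<open>\<F>\<^sub>p\<^sup>k\<close> is \<open>'p mod_ring ^ 'k\<close> with \<open>k = CARD('k) \<ge> 1\<close>.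
\<close>

definition supp :: "'a::zero ^ 'k \<Rightarrow> 'k set" where
  "supp s = {i. s $ i \<noteq> 0}"

text \<open>An array \<open>a\<close> has entry \<open>a x y\<close> in row \<open>x\<close> and column \<open>y\<close>.\<close>

type_synonym 'p parray = "'p mod_ring \<Rightarrow> 'p mod_ring \<Rightarrow> int"

definition common_sum :: "'p::prime_card parray \<Rightarrow> int \<Rightarrow> bool" where
  "common_sum a g \<longleftrightarrow> (\<forall>x. (\<Sum>y\<in>UNIV. a x y) = g) \<and> (\<forall>y. (\<Sum>x\<in>UNIV. a x y) = g)"

definition W :: "'p::prime_card parray set" where
  "W = {a. \<exists>g. common_sum a g}"

definition gam :: "'p::prime_card parray \<Rightarrow> int" where
  "gam a = (THE g. common_sum a g)"

text \<open>
  The index \<open>p - 1 - y\<close>, computed on the representatives \<open>0, \<dots>, p - 1\<close>; as an element of the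
  field it is \<open>- 1 - y\<close>.
\<close>

definition refl_index :: "'p::prime_card mod_ring \<Rightarrow> 'p mod_ring" where
  "refl_index y = of_int_mod_ring (int CARD('p) - 1 - to_int_mod_ring y)"

definition sum_direct :: "'p::prime_card mod_ring ^ 'k ^ 'k \<Rightarrow> ('k \<Rightarrow> 'p parray) \<Rightarrow> int" where
  "sum_direct L a = (\<Sum>v\<in>UNIV. \<Prod>i\<in>UNIV. a i ((L *v v) $ i) (v $ i))"

definition sum_reflected :: "'p::prime_card mod_ring ^ 'k ^ 'k \<Rightarrow> ('k \<Rightarrow> 'p parray) \<Rightarrow> int" where
  "sum_reflected L a = (\<Sum>v\<in>UNIV. \<Prod>i\<in>UNIV. a i ((L *v v) $ i) (refl_index (v $ i)))"

end

theory Submission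
  imports Defs
begin

text \<open>
  Since \<open>refl_index\<close> permutes the columns, the reflected sum of a family of arrays in \<open>W\<close> is the
  direct sum of another family in \<open>W\<close> with the same line sums, so only the direct identity matters.

  Detect \<open>u = L v\<close> by the additive characters \<open>w \<mapsto> \<chi> (s \<cdot> w)\<close>. Then \<open>p\<^sup>k\<close> times the direct sum
  becomes the sum over \<open>s\<close> of \<open>\<Prod>\<^sub>i A\<^sub>i (s\<^sub>i, (L\<^sup>T s)\<^sub>i)\<close>, where \<open>A\<^sub>i (r, t)\<close> is the Fourier transform
  of the \<open>i\<close>-th array at frequency \<open>(r, -t)\<close>. Constant line sums say exactly that \<open>A\<^sub>i (r, t) = 0\<close>
  when one of \<open>r\<close>, \<open>t\<close> vanishes and the other does not; hence only those \<open>s\<close> contribute for which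
  \<open>s\<close> and \<open>L\<^sup>T s\<close> have the same support, and \<open>s = 0\<close> contributes \<open>\<Prod>\<^sub>i p \<gamma>\<^sub>i\<close>.

  Conversely, if \<open>s \<noteq> 0\<close> and \<open>t = L\<^sup>T s\<close> have equal supports, let \<open>a\<^sub>i\<close> be the indicator of the line
  \<open>s\<^sub>i x - t\<^sub>i y = c\<^sub>i\<close>, where \<open>c\<close> is a unit vector supported in \<open>supp s\<close>. All \<open>\<gamma>\<^sub>i\<close> are positive,
  but the direct sum is empty, because \<open>s \<cdot> L v - t \<cdot> v = 0\<close> for all \<open>v\<close> whereas the \<open>c\<^sub>i\<close> sum to \<open>1\<close>.
\<close>

lemma dot_matrix_vector:
  fixes L :: "'a::comm_semiring_1 ^ 'n ^ 'm"
  shows "(\<Sum>i\<in>UNIV. s $ i * (L *v v) $ i) = (\<Sum>j\<in>UNIV. (transpose L *v s) $ j * v $ j)"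
  unfolding matrix_vector_mult_def transpose_def
  by (simp add: sum_distrib_left sum_distrib_right) (subst sum.swap, simp add: mult_ac)

lemma prod_sum_vec:
  fixes f :: "'k::finite \<Rightarrow> 'a::finite \<Rightarrow> 'b::comm_semiring_1"
  shows "(\<Prod>i\<in>UNIV. \<Sum>x\<in>UNIV. f i x) = (\<Sum>v\<in>UNIV. \<Prod>i\<in>UNIV. f i (v $ i))"
proof -
  have "(\<Prod>i\<in>UNIV. \<Sum>x\<in>UNIV. f i x) = (\<Sum>g\<in>UNIV. \<Prod>i\<in>UNIV. f i (g i))"
    by (subst prod_sum_PiE) (auto simp: PiE_def)
  also have "\<dots> = (\<Sum>v\<in>UNIV. \<Prod>i\<in>UNIV. f i (v $ i))"
    by (rule sum.reindex_bij_witness[of _ vec_nth vec_lambda]) auto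
  finally show ?thesis .
qed

section \<open>The additive character of the prime field\<close>

definition chi :: "'p::prime_card mod_ring \<Rightarrow> complex" where
  "chi x = cis (2 * pi / CARD('p)) ^ nat (to_int_mod_ring x)"

lemma chi_0: "chi 0 = 1"
  by (simp add: chi_def)

lemma chi_add: "chi (x + y) = chi x * chi (y :: 'p::prime_card mod_ring)"
proof -
  define z where "z = cis (2 * pi / CARD('p))"
  have z: "z ^ CARD('p) = 1"
    by (simp add: z_def Complex.DeMoivre)
  \<comment> \<open>The base is a \<open>p\<close>-th root of unity, so exponents matter only mod
    \<open>p\<close>; this makes \<open>chi\<close> additive although it is defined on
    representatives.\<close>
  have mod: "z ^ (n mod CARD('p)) = z ^ n" for n
    by (metis z mod_mult_div_eq power_add power_mult power_one mult_1_right)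
  have "nat (to_int_mod_ring (x + y))
      = (nat (to_int_mod_ring x) + nat (to_int_mod_ring y)) mod CARD('p)"
    by transfer (simp add: nat_mod_distrib nat_add_distrib)
  then show ?thesis
    by (simp add: chi_def flip: z_def) (simp add: mod power_add)
qed

lemma chi_sum: "chi (sum f A) = (\<Prod>i\<in>A. chi (f i))"
  by (induction A rule: infinite_finite_induct) (auto simp: chi_0 chi_add)

lemma chi_1: "chi (1 :: 'p::prime_card mod_ring) \<noteq> 1"
proof
  have p: "CARD('p) > 1"
    using prime_card[where 'a='p] prime_gt_1_nat by blast
  assume "chi (1 :: 'p mod_ring) = 1"
  then have "cis (2 * pi / CARD('p)) = 1"
    by (simp add: chi_def)
  \<comment> \<open>The real part reads \<open>cos (2 * pi / p) = 1\<close>, and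
    \<open>cos (2 * x) = 1 - 2 * (sin x)^2\<close>.\<close>
  then have "sin (pi / CARD('p)) = 0"
    using cos_double_sin[of "pi / CARD('p)"] by (simp add: complex_eq_iff)
  moreover have "sin (pi / CARD('p)) > 0"
    using p by (intro sin_gt_zero) (auto simp: field_simps)
  ultimately show False by simp
qed

lemma sum_chi: "(\<Sum>x\<in>UNIV. chi (r * x)) = (if r = 0 then of_nat CARD('p) else 0)"
  for r :: "'p::prime_card mod_ring"
proof (cases "r = 0")
  case True
  then show ?thesis by (simp add: chi_0)
next
  case False
  let ?S = "\<Sum>x\<in>UNIV. chi (r * x)"
  \<comment> \<open>Shifting \<open>x\<close> by \<open>inverse r\<close> multiplies the sum by
    \<open>chi 1\<close>, which is not 1, so the sum vanishes.\<close>
  have "?S = (\<Sum>x\<in>UNIV. chi (r * (x + inverse r)))"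
    by (rule sum.reindex_bij_witness[of _ "\<lambda>x. x + inverse r" "\<lambda>x. x - inverse r"]) auto
  also have "\<dots> = ?S * chi (1 :: 'p mod_ring)"
    using False by (simp add: distrib_left chi_add sum_distrib_right)
  finally show ?thesis
    using False chi_1[where 'p='p] by simp
qed

lemma sum_chi_vec:
  fixes w :: "'p::prime_card mod_ring ^ 'k"
  shows "(\<Sum>s\<in>UNIV. chi (\<Sum>i\<in>UNIV. s $ i * w $ i)) = (if w = 0 then of_nat CARD('p) ^ CARD('k) else 0)"
proof -
  have "(\<Sum>s\<in>UNIV. chi (\<Sum>i\<in>UNIV. s $ i * w $ i)) = (\<Sum>s\<in>UNIV. \<Prod>i\<in>UNIV. chi (w $ i * s $ i))"
    by (simp add: chi_sum mult.commute)
  also have "\<dots> = (\<Prod>i\<in>UNIV. \<Sum>x\<in>UNIV. chi (w $ i * x))"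
    by (rule prod_sum_vec[symmetric])
  also have "\<dots> = (if w = 0 then of_nat CARD('p) ^ CARD('k) else 0)"
    by (auto simp: sum_chi vec_eq_iff)
  finally show ?thesis .
qed

section \<open>Arrays with constant line sums\<close>

lemma gam_eqI: "common_sum a g \<Longrightarrow> gam a = g"
  unfolding gam_def by (rule the_equality) (auto simp: common_sum_def)

lemma common_sum_gam: "a \<in> W \<Longrightarrow> common_sum a (gam a)"
  using gam_eqI by (auto simp: W_def)

definition fourier :: "'p::prime_card parray \<Rightarrow> 'p mod_ring \<Rightarrow> 'p mod_ring \<Rightarrow> complex" where
  "fourier a r t = (\<Sum>x\<in>UNIV. \<Sum>y\<in>UNIV. of_int (a x y) * chi (r * x - t * y))"

text \<open>With \<open>t = 0\<close> the character ignores \<open>y\<close>, so the inner sum is a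
  row sum \<open>g\<close>, and orthogonality handles the remaining sum over
  \<open>x\<close>.\<close>

lemma fourier_zero_right:
  fixes a :: "'p::prime_card parray"
  assumes "common_sum a g"
  shows "fourier a r 0 = of_int g * (if r = 0 then of_nat CARD('p) else 0)"
proof -
  have "fourier a r 0 = (\<Sum>x\<in>UNIV. of_int (\<Sum>y\<in>UNIV. a x y) * chi (r * x))"
    by (simp add: fourier_def sum_distrib_right)
  also have "\<dots> = of_int g * (\<Sum>x\<in>UNIV. chi (r * x))"
    using assms unfolding common_sum_def by (simp add: sum_distrib_left del: of_int_sum)
  finally show ?thesis by (simp only: sum_chi)
qed

lemma fourier_zero_left:
  fixes a :: "'p::prime_card parray"
  assumes "common_sum a g" "t \<noteq> 0"
  shows "fourier a 0 t = 0"
proof -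
  have "fourier a 0 t = (\<Sum>y\<in>UNIV. of_int (\<Sum>x\<in>UNIV. a x y) * chi (- t * y))"
    unfolding fourier_def by (subst sum.swap) (simp add: sum_distrib_right)
  also have "\<dots> = of_int g * (\<Sum>y\<in>UNIV. chi (- t * y))"
    using assms unfolding common_sum_def by (simp add: sum_distrib_left del: of_int_sum)
  finally show ?thesis using assms(2) by (simp only: sum_chi) simp
qed

lemma sum_direct_fourier:
  fixes L :: "'p::prime_card mod_ring ^ 'k ^ 'k"
  shows "of_nat CARD('p) ^ CARD('k) * of_int (sum_direct L a)
    = (\<Sum>s\<in>UNIV. \<Prod>i\<in>UNIV. fourier (a i) (s $ i) ((transpose L *v s) $ i))"
proof -
  define F where "F u v = (\<Prod>i\<in>UNIV. complex_of_int (a i (u $ i) (v $ i)))"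
    for u v :: "'p mod_ring ^ 'k"
  define E where "E s u v = chi (\<Sum>i\<in>UNIV. s $ i * u $ i - (transpose L *v s) $ i * v $ i)"
    for s u v :: "'p mod_ring ^ 'k"
  have E: "(\<Sum>s\<in>UNIV. E s u v) = (if u = L *v v then of_nat CARD('p) ^ CARD('k) else 0)" for u v
  proof -
    have "(\<Sum>s\<in>UNIV. E s u v) = (\<Sum>s\<in>UNIV. chi (\<Sum>i\<in>UNIV. s $ i * (u - L *v v) $ i))"
      unfolding E_def
      by (simp add: sum_subtractf right_diff_distrib dot_matrix_vector)
    then show ?thesis by (simp only: sum_chi_vec right_minus_eq)
  qed
  have "(\<Sum>s\<in>UNIV. \<Prod>i\<in>UNIV. fourier (a i) (s $ i) ((transpose L *v s) $ i))
      = (\<Sum>s\<in>UNIV. \<Sum>u\<in>UNIV. \<Sum>v\<in>UNIV. F u v * E s u v)"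
    \<comment> \<open>Each product of coordinate sums expands into a sum over vectors
      \<open>u\<close>, \<open>v\<close>, and the characters of the coordinates multiply to
      \<open>E s u v\<close>.\<close>
    unfolding fourier_def prod_sum_vec F_def E_def chi_sum prod.distrib ..
  also have "\<dots> = (\<Sum>u\<in>UNIV. \<Sum>v\<in>UNIV. \<Sum>s\<in>UNIV. F u v * E s u v)"
    by (subst sum.swap, rule sum.cong, rule refl, rule sum.swap)
  also have "\<dots> = (\<Sum>v\<in>UNIV. \<Sum>u\<in>UNIV. F u v * (\<Sum>s\<in>UNIV. E s u v))"
    by (subst sum.swap) (simp only: sum_distrib_left)
  also have "\<dots> = of_nat CARD('p) ^ CARD('k) * (\<Sum>v\<in>UNIV. F (L *v v) v)"
    by (simp add: E if_distrib[of "\<lambda>x. F _ _ * x"] sum_distrib_left mult.commute cong: if_cong)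
  finally show ?thesis
    by (simp add: sum_direct_def F_def)
qed

lemma sum_direct_eq_prod_gam:
  fixes L :: "'p::prime_card mod_ring ^ 'k ^ 'k"
  assumes supp: "\<And>s. s \<noteq> 0 \<Longrightarrow> supp (transpose L *v s) \<noteq> supp s"
    and W: "\<And>i. a i \<in> W"
  shows "sum_direct L a = (\<Prod>i\<in>UNIV. gam (a i))"
proof -
  have "(\<Prod>i\<in>UNIV. fourier (a i) (s $ i) ((transpose L *v s) $ i)) = 0" if s: "s \<noteq> 0" for s
  proof -
    obtain i where "(s $ i = 0) \<noteq> ((transpose L *v s) $ i = 0)"
      using supp[OF s] by (auto simp: supp_def)
    then have "fourier (a i) (s $ i) ((transpose L *v s) $ i) = 0"
      using fourier_zero_right[OF common_sum_gam[OF W]] fourier_zero_left[OF common_sum_gam[OF W]]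
      by (cases "s $ i = 0") auto
    then show ?thesis by auto
  qed
  then have "of_nat CARD('p) ^ CARD('k) * complex_of_int (sum_direct L a)
      = (\<Sum>s\<in>{0}. \<Prod>i\<in>UNIV. fourier (a i) (s $ i) ((transpose L *v s) $ i))"
    unfolding sum_direct_fourier by (intro sum.mono_neutral_right) auto
  also have "\<dots> = (\<Prod>i\<in>UNIV. of_nat CARD('p) * complex_of_int (gam (a i)))"
    using fourier_zero_right[OF common_sum_gam[OF W], of _ 0] by (simp add: mult.commute)
  also have "\<dots> = of_nat CARD('p) ^ CARD('k) * complex_of_int (\<Prod>i\<in>UNIV. gam (a i))"
    by (simp add: prod.distrib)
  finally show ?thesis
    by (simp del: of_int_prod)
qed

section \<open>Necessity of the support condition\<close>

definition line_array :: "'p::prime_card mod_ring \<Rightarrow> 'p mod_ring \<Rightarrow> 'p mod_ring \<Rightarrow> 'p parray" where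
  "line_array r t c x y = of_bool (r * x - t * y = c)"

text \<open>If \<open>r = t = 0\<close>, then \<open>c = 0\<close> makes the equation void: all
  entries are 1 and the line sums are \<open>p\<close>. Otherwise both coefficients are invertible
  and each row and column meets the line once.\<close>

lemma common_sum_line_array:
  fixes r t c :: "'p::prime_card mod_ring"
  assumes "r = 0 \<longleftrightarrow> t = 0" "r = 0 \<Longrightarrow> c = 0"
  obtains g where "g \<noteq> 0" "common_sum (line_array r t c) g"
proof (cases "r = 0")
  case True
  then have "common_sum (line_array r t c) (int CARD('p))"
    using assms by (simp add: common_sum_def line_array_def)
  then show ?thesis using that[of "int CARD('p)"] by simp
next
  case False
  have "{y. r * x - t * y = c} = {(r * x - c) / t}"
    and "{x. r * x - t * y = c} = {(c + t * y) / r}" for x y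
    using False assms by (auto simp: field_simps)
  then have "common_sum (line_array r t c) 1"
    by (simp add: common_sum_def line_array_def)
  then show ?thesis using that[of 1] by simp
qed

lemma sum_direct_neq_prod_gam:
  fixes L :: "'p::prime_card mod_ring ^ 'k ^ 'k"
  assumes "s \<noteq> 0" "supp (transpose L *v s) = supp s"
  obtains a where "\<And>i. a i \<in> W" "sum_direct L a \<noteq> (\<Prod>i\<in>UNIV. gam (a i))"
proof -
  define t where "t = transpose L *v s"
  obtain i0 where i0: "s $ i0 \<noteq> 0"
    using \<open>s \<noteq> 0\<close> by (auto simp: vec_eq_iff)
  \<comment> \<open>Choosing \<open>i0\<close> in the support of \<open>s\<close> keeps the
    right-hand side 0 wherever both coefficients vanish.\<close>
  define a where "a i = line_array (s $ i) (t $ i) (of_bool (i = i0))" for i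
  have st: "s $ i = 0 \<longleftrightarrow> t $ i = 0" for i
    using assms(2) by (auto simp: supp_def t_def)
  have a: "a i \<in> W \<and> gam (a i) \<noteq> 0" for i
  proof -
    have "of_bool (i = i0) = (0 :: 'p mod_ring)" if "s $ i = 0"
      using that i0 by auto
    then obtain g where "g \<noteq> 0" "common_sum (a i) g"
      unfolding a_def by (rule common_sum_line_array[OF st])
    then show ?thesis using gam_eqI by (auto simp: W_def)
  qed
  have "(\<Prod>i\<in>UNIV. a i ((L *v v) $ i) (v $ i)) = 0" for v
  proof (rule ccontr)
    assume "(\<Prod>i\<in>UNIV. a i ((L *v v) $ i) (v $ i)) \<noteq> 0"
    then have "s $ i * (L *v v) $ i - t $ i * v $ i = of_bool (i = i0)" for i
      by (auto simp: a_def line_array_def)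
    then have "(\<Sum>i\<in>UNIV. s $ i * (L *v v) $ i - t $ i * v $ i) = (\<Sum>i\<in>UNIV. of_bool (i = i0))"
      by simp
    then show False
      by (simp add: sum_subtractf dot_matrix_vector t_def of_bool_def)
  qed
  then have "sum_direct L a = 0"
    unfolding sum_direct_def by (intro sum.neutral) blast
  moreover have "(\<Prod>i\<in>UNIV. gam (a i)) \<noteq> 0"
    using a by simp
  ultimately show ?thesis
    using that[of a] a by metis
qed

section \<open>Reflecting the columns\<close>

lemma refl_index_refl_index: "refl_index (refl_index y) = y"
  for y :: "'p::prime_card mod_ring"
proof -
  have "refl_index x = - 1 - x" for x :: "'p mod_ring"
    unfolding refl_index_def by transfer (simp add: mod_simps)
  then show ?thesis by simp
qed

definition reflect :: "'p::prime_card parray \<Rightarrow> 'p parray" where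
  "reflect a x y = a x (refl_index y)"

lemma reflect_reflect: "reflect (reflect a) = a"
  by (simp add: reflect_def refl_index_refl_index fun_eq_iff)

lemma common_sum_reflect: "common_sum (reflect a) = common_sum a"
proof -
  have "(\<Sum>y\<in>UNIV. reflect a x y) = (\<Sum>y\<in>UNIV. a x y)" for x
    unfolding reflect_def
    by (rule sum.reindex_bij_witness[of _ refl_index refl_index]) (auto simp: refl_index_refl_index)
  moreover have "(\<forall>y. (\<Sum>x\<in>UNIV. reflect a x y) = g) \<longleftrightarrow> (\<forall>y. (\<Sum>x\<in>UNIV. a x y) = g)" for g
    unfolding reflect_def by (metis refl_index_refl_index)
  ultimately show ?thesis by (simp add: common_sum_def fun_eq_iff)
qed

text \<open>Reflection is an involution on \<open>W\<close> preserving \<open>gam\<close> and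
  exchanging the two sums, so the quantifier over families absorbs it.\<close>

lemma all_W_reflect_iff:
  fixes L :: "'p::prime_card mod_ring ^ 'k ^ 'k"
  shows "(\<forall>a. (\<forall>i. a i \<in> W) \<longrightarrow> sum_reflected L a = (\<Prod>i\<in>UNIV. gam (a i))) \<longleftrightarrow>
   (\<forall>a. (\<forall>i. a i \<in> W) \<longrightarrow> sum_direct L a = (\<Prod>i\<in>UNIV. gam (a i)))"
    (is "(\<forall>a. ?P a) \<longleftrightarrow> (\<forall>a. ?Q a)")
proof -
  have "sum_reflected L a = sum_direct L (\<lambda>i. reflect (a i))" for a
    by (simp add: sum_reflected_def sum_direct_def reflect_def)
  then have PQ: "?P a \<longleftrightarrow> ?Q (\<lambda>i. reflect (a i))" for a
    by (simp add: W_def gam_def common_sum_reflect)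
  have "?Q a \<longleftrightarrow> ?P (\<lambda>i. reflect (a i))" for a
    using PQ[of "\<lambda>i. reflect (a i)"] by (simp only: reflect_reflect)
  with PQ show ?thesis by (intro iffI allI) simp_all
qed

theorem theorem3p5:
  fixes L :: "'p::prime_card mod_ring ^ 'k ^ 'k"
  assumes "invertible L"
  shows
    "((\<forall>s. s \<noteq> 0 \<longrightarrow> supp (transpose L *v s) \<noteq> supp s) \<longleftrightarrow>
      (\<forall>a. (\<forall>i. a i \<in> W) \<longrightarrow>
        sum_direct L a = sum_reflected L a \<and>
        sum_reflected L a = (\<Prod>i\<in>UNIV. gam (a i)))) \<and>
     ((\<forall>s. s \<noteq> 0 \<longrightarrow> supp (transpose L *v s) \<noteq> supp s) \<longleftrightarrow>
      (\<forall>a. (\<forall>i. a i \<in> W) \<longrightarrow> sum_direct L a = (\<Prod>i\<in>UNIV. gam (a i)))) \<and>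
     ((\<forall>s. s \<noteq> 0 \<longrightarrow> supp (transpose L *v s) \<noteq> supp s) \<longleftrightarrow>
      (\<forall>a. (\<forall>i. a i \<in> W) \<longrightarrow> sum_reflected L a = (\<Prod>i\<in>UNIV. gam (a i))))"
proof -
  have "(\<forall>s. s \<noteq> 0 \<longrightarrow> supp (transpose L *v s) \<noteq> supp s) \<longleftrightarrow>
      (\<forall>a. (\<forall>i. a i \<in> W) \<longrightarrow> sum_direct L a = (\<Prod>i\<in>UNIV. gam (a i)))"
    using sum_direct_eq_prod_gam sum_direct_neq_prod_gam by metis
  then show ?thesis
    using all_W_reflect_iff[of L] by auto
qed

end
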